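(* Let $\boldsymbol{n}$ be an observed outcome table of a stratified experiment with $K$ strata whose first $\ell$ strata ($1\le \ell\le K$) are balanced, let $\alpha\in(0,1)$, and fix treatment allocations $\boldsymbol{W}_1,\dots,\boldsymbol{W}_R$ that are used in all permutation tests. Let $$S^*:=\{\tau(\boldsymbol{v}) : \boldsymbol{v}\text{ is a potential outcome table algebraically compatible with }\boldsymbol{n}\text{ and } p(\boldsymbol{v},\boldsymbol{n})>\alpha\}$$ be the $1-\alpha$ confidence set for the average treatment effect obtained by performing a permutation test of every algebraically compatible potential outcome table. Then the algorithm described in the context, run on input $(\boldsymbol{n},\alpha)$, returns a set $S$ with $S=S^*$, and the number of potential outcome tables on which it performs a permutation test is at most $$O\Big(\Big(\sum_{k=1}^{\ell} n_k\Big)\times\prod_{k=1}^{\ell} n_k^2\times\prod_{k=\ell+1}^{K} n_k^3\Big).$$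
   Context: **Setting.** There are $K$ strata; stratum $k$ has $n_k$ subjects, of which $m_k$ ($0<m_k<n_k$) are assigned to treatment and $n_k-m_k$ to control, by simple random sampling, independently across strata; $n=\sum_{k=1}^K n_k$. An allocation is $\boldsymbol{z}=(z_{kj})$ with $z_{kj}\in\{0,1\}$, $1\le k\le K$, $1\le j\le n_k$, and $\sum_j z_{kj}=m_k$ for each $k$ ($1$ = treatment, $0$ = control); the random allocation $\boldsymbol{Z}$ is uniform on all such $\boldsymbol{z}$. Stratum $k$ is *balanced* if $n_k=2m_k$. **Tables.** A *potential outcome table* is $\boldsymbol{v}=(v_{k11},v_{k10},v_{k01},v_{k00})_{k=1}^K$, nonnegative integers with $v_{k11}+v_{k10}+v_{k01}+v_{k00}=n_k$; $v_{kab}$ is the number of subjects in stratum $k$ whose (binary) response would be $a$ under treatment and $b$ under control. Its average treatment effect is $\tau(\boldsymbol{v})=\frac1n\sum_{k=1}^K(v_{k10}-v_{k01})$. An *outcome table* is $\boldsymbol{n}=(n_{k11},n_{k10},n_{k01},n_{k00})_{k=1}^K$, where $n_{kuw}$ is the number of subjects in stratum $k$ with treatment assignment $u$ and observed response $w$; so $n_{k11}+n_{k10}=m_k$ and $n_{k01}+n_{k00}=n_k-m_k$. The estimated average treatment effect is $$\hat\tau(\boldsymbol{n})=\frac1n\sum_{k=1}^K n_k\Big(\frac{n_{k11}}{m_k}-\frac{n_{k01}}{n_k-m_k}\Big).$$ **Unpacking and compatibility.** The *canonical unpacking* of $\boldsymbol{v}$ assigns potential outcomes $(y_{kj}(1),y_{kj}(0))$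 to the subjects of stratum $k$ in order: $(1,1)$ to the first $v_{k11}$ subjects, $(1,0)$ to the next $v_{k10}$, $(0,1)$ to the next $v_{k01}$, and $(0,0)$ to the last $v_{k00}$. For an allocation $\boldsymbol{z}$, $\bar{\bar{\boldsymbol{n}}}(\boldsymbol{v},\boldsymbol{z})$ is the outcome table resulting from applying $\boldsymbol{z}$ to this unpacking (subject $j$ in stratum $k$ has observed response $z_{kj}y_{kj}(1)+(1-z_{kj})y_{kj}(0)$). The table $\boldsymbol{v}$ is *algebraically compatible* with $\boldsymbol{n}$ if $\boldsymbol{n}=\bar{\bar{\boldsymbol{n}}}(\boldsymbol{v},\boldsymbol{z})$ for some allocation $\boldsymbol{z}$ with $\mathbb P(\boldsymbol{Z}=\boldsymbol{z})>0$. **Permutation test.** Given allocations $\boldsymbol{W}_1,\dots,\boldsymbol{W}_R$, $$p(\boldsymbol{v},\boldsymbol{n})=\frac{\#\{r\in\{1,\dots,R\}: |\tau(\boldsymbol{v})-\hat\tau(\bar{\bar{\boldsymbol{n}}}(\boldsymbol{v},\boldsymbol{W}_r))|\ge|\tau(\boldsymbol{v})-\hat\tau(\boldsymbol{n})|\}+1}{R+1}.$$ A permutation test with $\boldsymbol{v}$ at level $\alpha$ rejects $\boldsymbol{v}$ if $p(\boldsymbol{v},\boldsymbol{n})\le\alpha$ and accepts it otherwise. **Algorithm.** Start with $S=\emptyset$. For every integer tuple $$(u_{111},\dots,u_{K11},u_{100},\dots,u_{K00},u_{(\ell+1)10},\dots,u_{K10},a)$$ with $0\le u_{k11}\le n_k$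 and $0\le u_{k00}\le n_k-u_{k11}$ for all $k\in\{1,\dots,K\}$, $0\le u_{k10}\le n_k-u_{k11}-u_{k00}$ for $k\in\{\ell+1,\dots,K\}$, and $|a|\le\sum_{k=1}^\ell(n_k-u_{k00}-u_{k11})$: (a) find a potential outcome table $\boldsymbol{v}$ algebraically compatible with $\boldsymbol{n}$ such that $v_{k11}=u_{k11}$ and $v_{k00}=u_{k00}$ for all $k\in\{1,\dots,K\}$, $v_{k10}=u_{k10}$ for $k\in\{\ell+1,\dots,K\}$, and $\sum_{k=1}^\ell(v_{k10}-v_{k01})=a$; if none exists, go on to the next tuple; (b) if $\tau(\boldsymbol{v})\in S$, go on to the next tuple; otherwise perform a permutation test with $\boldsymbol{v}$ at level $\alpha$, and if $\boldsymbol{v}$ is accepted, add $\tau(\boldsymbol{v})$ to $S$. Finally return $S$. (Any choice of $\boldsymbol{v}$ satisfying the requirements in (a) is allowed.) **Asymptotic convention.** The implied constant in $O(\cdot)$ may depend on $K$ but not on the $n_k$, $m_k$, $\ell$, $\boldsymbol{n}$, $R$ or $\alpha$. *)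

theory Defs
  imports "HOL-Probability.Probability"
begin

text \<open>
  Strata are indexed by \<open>{1..K}\<close>, and the subjects of stratum \<open>k\<close> by \<open>{1..N k}\<close>, of
  whom \<open>M k\<close> are treated.  Treatment indicators and binary responses are Booleans
  (\<open>True\<close> for 1, \<open>False\<close> for 0).  The entry \<open>v k a b\<close> of a potential outcome table is
  $v_{kab}$, and the entry \<open>n k u w\<close> of an outcome table is $n_{kuw}$; only the entries
  with \<open>k \<in> {1..K}\<close> are meaningful.
\<close>

type_synonym table = "nat \<Rightarrow> bool \<Rightarrow> bool \<Rightarrow> nat"
type_synonym allocation = "nat \<Rightarrow> nat \<Rightarrow> bool"

definition stratified_design :: "nat \<Rightarrow> (nat \<Rightarrow> nat) \<Rightarrow> (nat \<Rightarrow> nat) \<Rightarrow> bool" where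
  "stratified_design K N M \<longleftrightarrow> (\<forall>k\<in>{1..K}. 0 < M k \<and> M k < N k)"

definition balanced :: "(nat \<Rightarrow> nat) \<Rightarrow> (nat \<Rightarrow> nat) \<Rightarrow> nat \<Rightarrow> bool" where
  "balanced N M k \<longleftrightarrow> N k = 2 * M k"

definition total_size :: "nat \<Rightarrow> (nat \<Rightarrow> nat) \<Rightarrow> nat" where
  "total_size K N = (\<Sum>k=1..K. N k)"

definition allocations :: "nat \<Rightarrow> (nat \<Rightarrow> nat) \<Rightarrow> (nat \<Rightarrow> nat) \<Rightarrow> allocation set" where
  "allocations K N M =
     {z \<in> (\<Pi>\<^sub>E k\<in>{1..K}. \<Pi>\<^sub>E j\<in>{1..N k}. UNIV).
        \<forall>k\<in>{1..K}. card {j\<in>{1..N k}. z k j} = M k}"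

definition random_allocation ::
    "nat \<Rightarrow> (nat \<Rightarrow> nat) \<Rightarrow> (nat \<Rightarrow> nat) \<Rightarrow> allocation pmf" where
  "random_allocation K N M = pmf_of_set (allocations K N M)"

definition potential_outcome_table :: "nat \<Rightarrow> (nat \<Rightarrow> nat) \<Rightarrow> table \<Rightarrow> bool" where
  "potential_outcome_table K N v \<longleftrightarrow>
     (\<forall>k\<in>{1..K}. v k True True + v k True False + v k False True + v k False False = N k)"

definition ate :: "nat \<Rightarrow> (nat \<Rightarrow> nat) \<Rightarrow> table \<Rightarrow> real" where
  "ate K N v =
     (\<Sum>k=1..K. real (v k True False) - real (v k False True)) / real (total_size K N)"

definition outcome_table ::
    "nat \<Rightarrow> (nat \<Rightarrow> nat) \<Rightarrow> (nat \<Rightarrow> nat) \<Rightarrow> table \<Rightarrow> bool" where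
  "outcome_table K N M n \<longleftrightarrow>
     (\<forall>k\<in>{1..K}. n k True True + n k True False = M k \<and>
                 n k False True + n k False False = N k - M k)"

definition est_ate ::
    "nat \<Rightarrow> (nat \<Rightarrow> nat) \<Rightarrow> (nat \<Rightarrow> nat) \<Rightarrow> table \<Rightarrow> real" where
  "est_ate K N M n =
     (\<Sum>k=1..K. real (N k) *
        (real (n k True True) / real (M k)
         - real (n k False True) / (real (N k) - real (M k)))) / real (total_size K N)"

text \<open>The canonical unpacking; the pair is $(y_{kj}(1), y_{kj}(0))$.\<close>

definition unpack :: "table \<Rightarrow> nat \<Rightarrow> nat \<Rightarrow> bool \<times> bool" where
  "unpack v k j =
     (if j \<le> v k True True then (True, True)
      else if j \<le> v k True True + v k True False then (True, False)
      else if j \<le> v k True True + v k True False + v k False True then (False, True)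
      else (False, False))"

definition response :: "table \<Rightarrow> allocation \<Rightarrow> nat \<Rightarrow> nat \<Rightarrow> bool" where
  "response v z k j = (if z k j then fst (unpack v k j) else snd (unpack v k j))"

definition resulting_table :: "(nat \<Rightarrow> nat) \<Rightarrow> table \<Rightarrow> allocation \<Rightarrow> table" where
  "resulting_table N v z =
     (\<lambda>k u w. card {j\<in>{1..N k}. z k j = u \<and> response v z k j = w})"

definition compatible ::
    "nat \<Rightarrow> (nat \<Rightarrow> nat) \<Rightarrow> (nat \<Rightarrow> nat) \<Rightarrow> table \<Rightarrow> table \<Rightarrow> bool" where
  "compatible K N M v n \<longleftrightarrow>
     (\<exists>z\<in>allocations K N M. pmf (random_allocation K N M) z > 0 \<and>
        (\<forall>k\<in>{1..K}. n k = resulting_table N v z k))"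

definition p_value ::
    "nat \<Rightarrow> (nat \<Rightarrow> nat) \<Rightarrow> (nat \<Rightarrow> nat) \<Rightarrow> nat \<Rightarrow> (nat \<Rightarrow> allocation) \<Rightarrow> table \<Rightarrow> table \<Rightarrow> real" where
  "p_value K N M R W v n =
     (real (card {r\<in>{1..R}.
        \<bar>ate K N v - est_ate K N M (resulting_table N v (W r))\<bar>
          \<ge> \<bar>ate K N v - est_ate K N M n\<bar>}) + 1) / (real R + 1)"

definition confidence_set ::
    "nat \<Rightarrow> (nat \<Rightarrow> nat) \<Rightarrow> (nat \<Rightarrow> nat) \<Rightarrow> nat \<Rightarrow> (nat \<Rightarrow> allocation) \<Rightarrow> table \<Rightarrow> real \<Rightarrow> real set" where
  "confidence_set K N M R W n \<alpha> =
     {ate K N v | v. potential_outcome_table K N v \<and> compatible K N M v n \<and>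
                     p_value K N M R W v n > \<alpha>}"

text \<open>
  A search tuple is \<open>(u11, u00, u10, a)\<close>.  The components are extensional functions, so
  that each tuple of integers is represented exactly once.
\<close>

type_synonym search_tuple = "(nat \<Rightarrow> nat) \<times> (nat \<Rightarrow> nat) \<times> (nat \<Rightarrow> nat) \<times> int"

definition search_tuples :: "nat \<Rightarrow> (nat \<Rightarrow> nat) \<Rightarrow> nat \<Rightarrow> search_tuple set" where
  "search_tuples K N l =
     {(u11, u00, u10, a).
        u11 \<in> (\<Pi>\<^sub>E k\<in>{1..K}. {0..N k}) \<and>
        u00 \<in> (\<Pi>\<^sub>E k\<in>{1..K}. {0..N k - u11 k}) \<and>
        u10 \<in> (\<Pi>\<^sub>E k\<in>{l+1..K}. {0..N k - u11 k - u00 k}) \<and>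
        \<bar>a\<bar> \<le> (\<Sum>k=1..l. int (N k) - int (u00 k) - int (u11 k))}"

definition candidate ::
    "nat \<Rightarrow> (nat \<Rightarrow> nat) \<Rightarrow> (nat \<Rightarrow> nat) \<Rightarrow> nat \<Rightarrow> table \<Rightarrow> search_tuple \<Rightarrow> table \<Rightarrow> bool" where
  "candidate K N M l n t v \<longleftrightarrow>
     (case t of (u11, u00, u10, a) \<Rightarrow>
        potential_outcome_table K N v \<and> compatible K N M v n \<and>
        (\<forall>k\<in>{1..K}. v k True True = u11 k \<and> v k False False = u00 k) \<and>
        (\<forall>k\<in>{l+1..K}. v k True False = u10 k) \<and>
        (\<Sum>k=1..l. int (v k True False) - int (v k False True)) = a)"

text \<open>
  One pass of the loop body.  The state consists of the set accumulated so far and the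
  list of tables on which a permutation test has been performed.  The rules leave the choice
  of the candidate table completely free (it may even depend on the state).
\<close>

inductive process ::
    "nat \<Rightarrow> (nat \<Rightarrow> nat) \<Rightarrow> (nat \<Rightarrow> nat) \<Rightarrow> nat \<Rightarrow> (nat \<Rightarrow> allocation) \<Rightarrow> nat \<Rightarrow> table \<Rightarrow> real \<Rightarrow>
     search_tuple \<Rightarrow> real set \<times> table list \<Rightarrow> real set \<times> table list \<Rightarrow> bool"
  for K N M R W l n \<alpha> where
  no_candidate:
    "\<nexists>v. candidate K N M l n t v \<Longrightarrow> process K N M R W l n \<alpha> t (S, T) (S, T)"
| already_found:
    "candidate K N M l n t v \<Longrightarrow> ate K N v \<in> S \<Longrightarrow>
     process K N M R W l n \<alpha> t (S, T) (S, T)"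
| test_rejects:
    "candidate K N M l n t v \<Longrightarrow> ate K N v \<notin> S \<Longrightarrow> p_value K N M R W v n \<le> \<alpha> \<Longrightarrow>
     process K N M R W l n \<alpha> t (S, T) (S, v # T)"
| test_accepts:
    "candidate K N M l n t v \<Longrightarrow> ate K N v \<notin> S \<Longrightarrow> \<not> p_value K N M R W v n \<le> \<alpha> \<Longrightarrow>
     process K N M R W l n \<alpha> t (S, T) (insert (ate K N v) S, v # T)"

inductive process_all ::
    "nat \<Rightarrow> (nat \<Rightarrow> nat) \<Rightarrow> (nat \<Rightarrow> nat) \<Rightarrow> nat \<Rightarrow> (nat \<Rightarrow> allocation) \<Rightarrow> nat \<Rightarrow> table \<Rightarrow> real \<Rightarrow>
     search_tuple list \<Rightarrow> real set \<times> table list \<Rightarrow> real set \<times> table list \<Rightarrow> bool"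
  for K N M R W l n \<alpha> where
  "process_all K N M R W l n \<alpha> [] s s"
| "process K N M R W l n \<alpha> t s s' \<Longrightarrow> process_all K N M R W l n \<alpha> ts s' s'' \<Longrightarrow>
   process_all K N M R W l n \<alpha> (t # ts) s s''"

text \<open>
  \<open>algorithm_run \<dots> S T\<close>: some execution of the algorithm, visiting the search tuples in some
  order, returns \<open>S\<close> and performs its permutation tests on exactly the tables listed in \<open>T\<close>.
\<close>

definition algorithm_run ::
    "nat \<Rightarrow> (nat \<Rightarrow> nat) \<Rightarrow> (nat \<Rightarrow> nat) \<Rightarrow> nat \<Rightarrow> (nat \<Rightarrow> allocation) \<Rightarrow> nat \<Rightarrow> table \<Rightarrow> real \<Rightarrow>
     real set \<Rightarrow> table list \<Rightarrow> bool" where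
  "algorithm_run K N M R W l n \<alpha> S T \<longleftrightarrow>
     (\<exists>ts. distinct ts \<and> set ts = search_tuples K N l \<and>
           process_all K N M R W l n \<alpha> ts ({}, []) (S, T))"

end

theory Submission
  imports Defs
begin

text \<open>
  In a balanced stratum $n_k/m_k = n_k/(n_k-m_k) = 2$, so only $n_{k11}-n_{k01}$ enters the
  estimator.  Subject $j$ contributes
  $z_j y_j(1) - (1-z_j) y_j(0) = z_j (y_j(1)+y_j(0)) - y_j(0)$ to this difference; under the
  canonical unpacking the first term depends only on $v_{k11}$ and $v_{k00}$, and the second one
  sums to $v_{k11}+v_{k01}$.  Hence two tables that agree on a search tuple have the same average
  treatment effect, and under each allocation the same estimate, so they have the same
  permutation p-value, and it suffices to test one of them.
\<close>

section \<open>Counts and differences under the canonical unpacking\<close>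

lemma card_control_responders:
  assumes "potential_outcome_table K N v" "k \<in> {1..K}"
  shows "card {j\<in>{1..N k}. snd (unpack v k j)} = v k True True + v k False True"
proof -
  let ?a = "v k True True" and ?b = "v k True False" and ?c = "v k False True"
  have tot: "?a + ?b + ?c + v k False False = N k"
    using assms by (auto simp: potential_outcome_table_def)
  \<comment> \<open>Responding under control are the types (1,1) and (0,1), which the unpacking
    places in two intervals separated by the block of type (1,0).\<close>
  have "{j\<in>{1..N k}. snd (unpack v k j)} = {1..?a} \<union> {?a + ?b + 1..?a + ?b + ?c}"
    using tot by (auto simp: unpack_def split: if_splits)
  moreover have "card ({1..?a} \<union> {?a + ?b + 1..?a + ?b + ?c}) = ?a + ?c"
    by (subst card_Un_disjoint) auto
  ultimately show ?thesis by simp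
qed

text \<open>Types (1,0) and (0,1) are adjacent in the unpacking and both have response sum 1. So the
  sum is 2 up to position \<open>v k True True\<close>, then 1 up to
  \<open>N k - v k False False\<close>, then 0; the border between the two middle types is invisible
  to it.\<close>

lemma unpack_response_sum_cong:
  assumes "potential_outcome_table K N v" "potential_outcome_table K N w" "k \<in> {1..K}"
    and "v k True True = w k True True" "v k False False = w k False False"
  shows "(of_bool (fst (unpack v k j)) + of_bool (snd (unpack v k j)) :: int) =
         of_bool (fst (unpack w k j)) + of_bool (snd (unpack w k j))"
proof -
  have "v k True True + v k True False + v k False True + v k False False = N k"
    "w k True True + w k True False + w k False True + w k False False = N k"
    using assms(1-3) by (auto simp: potential_outcome_table_def)
  with assms(4,5) show ?thesis by (auto simp: unpack_def)
qed

lemma resulting_table_difference: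
  assumes "potential_outcome_table K N v" "k \<in> {1..K}"
  shows "int (resulting_table N v z k True True) - int (resulting_table N v z k False True) =
         (\<Sum>j=1..N k. of_bool (z k j) *
            (of_bool (fst (unpack v k j)) + of_bool (snd (unpack v k j))))
         - int (v k True True) - int (v k False True)"
proof -
  \<comment> \<open>Counts become integer sums of indicators, so the difference can be compared
    subject by subject without truncated subtraction.\<close>
  have card_sum: "int (card {j\<in>{1..N k}. P j}) = (\<Sum>j=1..N k. of_bool (P j))" for P
    by (simp add: of_bool_def flip: sum.inter_filter)
  have "int (resulting_table N v z k True True) - int (resulting_table N v z k False True) =
        (\<Sum>j=1..N k. of_bool (z k j) *
            (of_bool (fst (unpack v k j)) + of_bool (snd (unpack v k j)))
            - of_bool (snd (unpack v k j)))"
    unfolding resulting_table_def card_sum sum_subtractf[symmetric]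
    by (rule sum.cong) (auto simp: response_def)
  also have "\<dots> = (\<Sum>j=1..N k. of_bool (z k j) *
            (of_bool (fst (unpack v k j)) + of_bool (snd (unpack v k j))))
         - int (card {j\<in>{1..N k}. snd (unpack v k j)})"
    unfolding card_sum by (rule sum_subtractf)
  finally show ?thesis
    using card_control_responders[OF assms] by simp
qed

text \<open>The differences themselves may disagree stratum by stratum, because
  \<open>v k False True\<close> is not fixed by the assumptions. Adding it back leaves a quantity
  determined by the allocation and the two shared counts.\<close>

lemma resulting_table_difference_cong:
  assumes "potential_outcome_table K N v" "potential_outcome_table K N w" "k \<in> {1..K}"
    and "v k True True = w k True True" "v k False False = w k False False"
  shows "int (resulting_table N v z k True True) - int (resulting_table N v z k False True)
           + int (v k False True) =
         int (resulting_table N w z k True True) - int (resulting_table N w z k False True)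
           + int (w k False True)"
  using assms(4)
  by (simp add: resulting_table_difference[OF assms(1,3)] resulting_table_difference[OF assms(2,3)]
      unpack_response_sum_cong[OF assms])

lemma resulting_table_cong:
  assumes "v k = w k"
  shows "resulting_table N v z k = resulting_table N w z k"
  using assms by (simp add: resulting_table_def response_def unpack_def)

section \<open>Tables that share a search tuple\<close>

text \<open>The tuple gives the sum of $v_{k10}+v_{k01}$ over the first \<open>l\<close> strata
  through \<open>u11\<close> and \<open>u00\<close>, and the sum of $v_{k10}-v_{k01}$ as
  \<open>a\<close>. Subtracting isolates the total of $v_{k01}$, so one integer does the work of
  \<open>l\<close> separate counts.\<close>

lemma candidate_sum_control_only:
  assumes "candidate K N M l n (u11, u00, u10, a) v" "l \<le> K"
  shows "2 * (\<Sum>k=1..l. int (v k False True)) =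
         (\<Sum>k=1..l. int (N k) - int (u11 k) - int (u00 k)) - a"
proof -
  have "int (N k) - int (u11 k) - int (u00 k) = int (v k True False) + int (v k False True)"
    if "k \<in> {1..l}" for k
    using assms that by (force simp: candidate_def potential_outcome_table_def)
  then have "(\<Sum>k=1..l. int (N k) - int (u11 k) - int (u00 k)) =
             (\<Sum>k=1..l. int (v k True False) + int (v k False True))"
    by (intro sum.cong) auto
  moreover have "a = (\<Sum>k=1..l. int (v k True False) - int (v k False True))"
    using assms by (simp add: candidate_def)
  ultimately show ?thesis by (simp add: sum.distrib sum_subtractf)
qed

text \<open>Beyond the first \<open>l\<close> strata the tuple prescribes three of the four counts,
  and the stratum size fixes the last.\<close>

lemma candidate_unbalanced_unique:
  assumes v: "candidate K N M l n t v" and w: "candidate K N M l n t w" and k: "k \<in> {l+1..K}"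
  shows "v k = w k"
proof -
  obtain u11 u00 u10 a where t: "t = (u11, u00, u10, a)" by (cases t)
  have K: "k \<in> {1..K}" using k by auto
  have "x k True True = u11 k" "x k False False = u00 k" "x k True False = u10 k"
      "x k True True + x k True False + x k False True + x k False False = N k"
    if "candidate K N M l n t x" for x
    using that k K unfolding candidate_def t potential_outcome_table_def case_prod_conv by blast+
  from this[OF v] this[OF w]
  have *: "v k True True = w k True True" "v k False False = w k False False"
      "v k True False = w k True False"
      "v k True True + v k True False + v k False True + v k False False = N k"
      "w k True True + w k True False + w k False True + w k False False = N k"
    by simp_all
  then have "v k False True = w k False True" by simp
  with * have "v k x y = w k x y" for x y by (cases x; cases y) auto
  then show ?thesis by blast
qed

lemma sum_split_strata:
  fixes f :: "nat \<Rightarrow> 'a::comm_monoid_add"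
  assumes "l \<le> K"
  shows "(\<Sum>k=1..K. f k) = (\<Sum>k=1..l. f k) + (\<Sum>k=l+1..K. f k)"
  using assms sum.ub_add_nat[of 1 l f "K - l"] by simp

lemma candidate_ate_eq:
  assumes v: "candidate K N M l n t v" and w: "candidate K N M l n t w" and l: "l \<le> K"
  shows "ate K N v = ate K N w"
proof -
  obtain u11 u00 u10 a where t: "t = (u11, u00, u10, a)" by (cases t)
  have first: "(\<Sum>k=1..l. real (x k True False) - real (x k False True)) = of_int a"
    if "candidate K N M l n t x" for x
  proof -
    have "a = (\<Sum>k=1..l. int (x k True False) - int (x k False True))"
      using that by (simp add: candidate_def t)
    then show ?thesis by simp
  qed
  have "(\<Sum>k=l+1..K. real (v k True False) - real (v k False True)) =
        (\<Sum>k=l+1..K. real (w k True False) - real (w k False True))"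
    using candidate_unbalanced_unique[OF v w] by (intro sum.cong) auto
  then show ?thesis
    unfolding ate_def sum_split_strata[OF l] first[OF v] first[OF w] by simp
qed

text \<open>All balanced strata carry the same weight 2, so only the total of their differences
  \<open>d\<close> matters. Two candidates may shift $v_{k01}$ from one balanced stratum to another,
  but these shifts cancel in the total.\<close>

lemma candidate_est_ate_eq:
  assumes v: "candidate K N M l n t v" and w: "candidate K N M l n t w" and l: "l \<le> K"
    and design: "stratified_design K N M" and bal: "\<forall>k\<in>{1..l}. balanced N M k"
  shows "est_ate K N M (resulting_table N v z) = est_ate K N M (resulting_table N w z)"
proof -
  obtain u11 u00 u10 a where t: "t = (u11, u00, u10, a)" by (cases t)
  define c where "c x k = real (N k) * (real (resulting_table N x z k True True) / real (M k)
      - real (resulting_table N x z k False True) / (real (N k) - real (M k)))" for x k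
  define d where "d x k = int (resulting_table N x z k True True)
      - int (resulting_table N x z k False True)" for x k
  have c: "c x k = 2 * of_int (d x k)" if "k \<in> {1..l}" for x k
  proof -
    have "M k > 0" "N k = 2 * M k"
      using design bal that l by (auto simp: stratified_design_def balanced_def)
    then show ?thesis by (simp add: c_def d_def field_simps)
  qed
  have "d v k + int (v k False True) = d w k + int (w k False True)" if "k \<in> {1..l}" for k
    unfolding d_def
    by (rule resulting_table_difference_cong[where K = K])
      (use v w that l in \<open>auto simp: candidate_def t\<close>)
  then have "(\<Sum>k=1..l. d v k + int (v k False True)) = (\<Sum>k=1..l. d w k + int (w k False True))"
    by (rule sum.cong[OF refl])
  moreover have "(\<Sum>k=1..l. int (v k False True)) = (\<Sum>k=1..l. int (w k False True))"
    using candidate_sum_control_only[OF v[unfolded t] l]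
      candidate_sum_control_only[OF w[unfolded t] l] by simp
  ultimately have "(\<Sum>k=1..l. d v k) = (\<Sum>k=1..l. d w k)"
    by (simp add: sum.distrib)
  moreover have "(\<Sum>k=1..l. c x k) = 2 * of_int (\<Sum>k=1..l. d x k)" for x
    by (simp add: c sum_distrib_left)
  ultimately have "(\<Sum>k=1..l. c v k) = (\<Sum>k=1..l. c w k)" by (simp only:)
  \<comment> \<open>In the other strata the two weights may differ, and the equality comes instead
    from the tables agreeing entry by entry.\<close>
  moreover have "(\<Sum>k=l+1..K. c v k) = (\<Sum>k=l+1..K. c w k)"
  proof (rule sum.cong[OF refl])
    fix k assume "k \<in> {l+1..K}"
    then have "v k = w k" by (rule candidate_unbalanced_unique[OF v w])
    then have "resulting_table N v z k = resulting_table N w z k" by (rule resulting_table_cong)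
    then show "c v k = c w k" by (simp add: c_def)
  qed
  ultimately have "(\<Sum>k=1..K. c v k) = (\<Sum>k=1..K. c w k)"
    by (simp only: sum_split_strata[OF l])
  then show ?thesis by (simp add: est_ate_def c_def)
qed

lemma candidate_p_value_eq:
  assumes "candidate K N M l n t v" "candidate K N M l n t w" "l \<le> K"
    and "stratified_design K N M" "\<forall>k\<in>{1..l}. balanced N M k"
  shows "p_value K N M R W v n = p_value K N M R W w n"
  unfolding p_value_def candidate_ate_eq[OF assms(1-3)] candidate_est_ate_eq[OF assms] ..

section \<open>Coverage and number of the search tuples\<close>

lemma compatible_table_has_search_tuple:
  assumes v: "potential_outcome_table K N v" "compatible K N M v n" and l: "l \<le> K"
  shows "\<exists>t\<in>search_tuples K N l. candidate K N M l n t v"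
proof
  let ?a = "\<Sum>k=1..l. int (v k True False) - int (v k False True)"
  let ?t = "(restrict (\<lambda>k. v k True True) {1..K}, restrict (\<lambda>k. v k False False) {1..K},
      restrict (\<lambda>k. v k True False) {l+1..K}, ?a)"
  have tot: "v k True True + v k True False + v k False True + v k False False = N k"
    if "k \<in> {1..K}" for k
    using v(1) that by (auto simp: potential_outcome_table_def)
  show "candidate K N M l n ?t v"
    using v l by (auto simp: candidate_def)
  \<comment> \<open>The bound on \<open>a\<close> excludes no table: in each stratum
    $|v_{k10}-v_{k01}| \<le> v_{k10}+v_{k01} = n_k-v_{k00}-v_{k11}$.\<close>
  have "\<bar>?a\<bar> \<le> (\<Sum>k=1..l. \<bar>int (v k True False) - int (v k False True)\<bar>)"
    by (rule sum_abs)
  also have "\<dots> \<le> (\<Sum>k=1..l. int (N k) - int (restrict (\<lambda>k. v k False False) {1..K} k)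
                 - int (restrict (\<lambda>k. v k True True) {1..K} k))"
  proof (rule sum_mono)
    fix k assume "k \<in> {1..l}"
    then have k: "k \<in> {1..K}" using l by auto
    show "\<bar>int (v k True False) - int (v k False True)\<bar> \<le>
        int (N k) - int (restrict (\<lambda>k. v k False False) {1..K} k)
        - int (restrict (\<lambda>k. v k True True) {1..K} k)"
      using k tot[OF k] by simp
  qed
  finally have a: "\<bar>?a\<bar> \<le> (\<Sum>k=1..l. int (N k) - int (restrict (\<lambda>k. v k False False) {1..K} k)
                 - int (restrict (\<lambda>k. v k True True) {1..K} k))" .
  have "restrict (\<lambda>k. v k True True) {1..K} \<in> (\<Pi>\<^sub>E k\<in>{1..K}. {0..N k})"
    using tot unfolding restrict_PiE_iff by force
  moreover have "restrict (\<lambda>k. v k False False) {1..K} \<in>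
      (\<Pi>\<^sub>E k\<in>{1..K}. {0..N k - restrict (\<lambda>k. v k True True) {1..K} k})"
    using tot unfolding restrict_PiE_iff by force
  moreover have "restrict (\<lambda>k. v k True False) {l+1..K} \<in>
      (\<Pi>\<^sub>E k\<in>{l+1..K}. {0..N k - restrict (\<lambda>k. v k True True) {1..K} k
          - restrict (\<lambda>k. v k False False) {1..K} k})"
    unfolding restrict_PiE_iff
  proof
    fix k assume "k \<in> {l+1..K}"
    then have "k \<in> {1..K}" by simp
    with tot[OF this] show "v k True False \<in>
        {0..N k - restrict (\<lambda>k. v k True True) {1..K} k
          - restrict (\<lambda>k. v k False False) {1..K} k}"
      by simp
  qed
  ultimately show "?t \<in> search_tuples K N l"
    using a unfolding search_tuples_def by blast
qed

text \<open>Relaxing the dependent ranges to a box of independent ones makes the cardinality a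
  product, at the cost of a constant factor that the bound can absorb.\<close>

lemma search_tuples_subset:
  "search_tuples K N l \<subseteq>
     (\<Pi>\<^sub>E k\<in>{1..K}. {0..N k}) \<times> (\<Pi>\<^sub>E k\<in>{1..K}. {0..N k}) \<times> (\<Pi>\<^sub>E k\<in>{l+1..K}. {0..N k}) \<times>
     {- int (\<Sum>k=1..l. N k)..int (\<Sum>k=1..l. N k)}"
proof
  fix t assume "t \<in> search_tuples K N l"
  then obtain u11 u00 u10 a where t: "t = (u11, u00, u10, a)"
    and u: "u11 \<in> (\<Pi>\<^sub>E k\<in>{1..K}. {0..N k})" "u00 \<in> (\<Pi>\<^sub>E k\<in>{1..K}. {0..N k - u11 k})"
      "u10 \<in> (\<Pi>\<^sub>E k\<in>{l+1..K}. {0..N k - u11 k - u00 k})"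
    and a: "\<bar>a\<bar> \<le> (\<Sum>k=1..l. int (N k) - int (u00 k) - int (u11 k))"
    by (auto simp: search_tuples_def)
  have "u00 \<in> (\<Pi>\<^sub>E k\<in>{1..K}. {0..N k})"
    using u(2) PiE_mono[of "{1..K}" "\<lambda>k. {0..N k - u11 k}" "\<lambda>k. {0..N k}"] by auto
  moreover have "u10 \<in> (\<Pi>\<^sub>E k\<in>{l+1..K}. {0..N k})"
    using u(3) PiE_mono[of "{l+1..K}" "\<lambda>k. {0..N k - u11 k - u00 k}" "\<lambda>k. {0..N k}"] by auto
  moreover have "(\<Sum>k=1..l. int (N k) - int (u00 k) - int (u11 k)) \<le> (\<Sum>k=1..l. int (N k))"
    by (rule sum_mono) simp
  ultimately show "t \<in> (\<Pi>\<^sub>E k\<in>{1..K}. {0..N k}) \<times> (\<Pi>\<^sub>E k\<in>{1..K}. {0..N k}) \<times>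
      (\<Pi>\<^sub>E k\<in>{l+1..K}. {0..N k}) \<times> {- int (\<Sum>k=1..l. N k)..int (\<Sum>k=1..l. N k)}"
    using u(1) a unfolding t mem_Times_iff fst_conv snd_conv atLeastAtMost_iff of_nat_sum
    by linarith
qed

lemma finite_search_tuples: "finite (search_tuples K N l)"
  by (rule finite_subset[OF search_tuples_subset]) (intro finite_cartesian_product finite_PiE; simp)

lemma prod_Suc_le:
  fixes N :: "nat \<Rightarrow> nat"
  assumes "\<And>k. k \<in> A \<Longrightarrow> N k \<ge> 1"
  shows "(\<Prod>k\<in>A. Suc (N k)) \<le> 2 ^ card A * (\<Prod>k\<in>A. N k)"
proof -
  have "(\<Prod>k\<in>A. Suc (N k)) \<le> (\<Prod>k\<in>A. 2 * N k)"
    by (rule prod_mono) (use assms in force)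
  then show ?thesis by (simp add: prod.distrib)
qed

text \<open>Each factor \<open>Suc (N k)\<close> costs a factor 2. There are \<open>K\<close> of
  them for each of \<open>u11\<close> and \<open>u00\<close> and \<open>K - l\<close> for
  \<open>u10\<close>, hence at most $2^{3K} = 8^K$; the range of \<open>a\<close> contributes the 3.
  The first \<open>l\<close> strata occur in two products and the others in three, which gives the
  exponents.\<close>

lemma card_search_tuples_le:
  assumes l: "1 \<le> l" "l \<le> K" and pos: "\<And>k. k \<in> {1..K} \<Longrightarrow> N k \<ge> 1"
  shows "card (search_tuples K N l) \<le>
     3 * 8 ^ K * ((\<Sum>k=1..l. N k) * (\<Prod>k=1..l. (N k)\<^sup>2) * (\<Prod>k=l+1..K. (N k) ^ 3))"
proof -
  let ?s = "\<Sum>k=1..l. N k" and ?p = "\<Prod>k=1..l. N k" and ?q = "\<Prod>k=l+1..K. N k"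
  let ?A = "\<Prod>k=1..K. Suc (N k)" and ?B = "\<Prod>k=l+1..K. Suc (N k)"
  have "card (search_tuples K N l) \<le> card (
     (\<Pi>\<^sub>E k\<in>{1..K}. {0..N k}) \<times> (\<Pi>\<^sub>E k\<in>{1..K}. {0..N k}) \<times> (\<Pi>\<^sub>E k\<in>{l+1..K}. {0..N k}) \<times>
     {- int ?s..int ?s})"
    by (rule card_mono[OF _ search_tuples_subset]) (intro finite_cartesian_product finite_PiE; simp)
  also have "\<dots> = ?A * (?A * (?B * (2 * ?s + 1)))"
    by (simp add: card_cartesian_product card_PiE nat_add_distrib nat_mult_distrib del: of_nat_sum)
  also have "\<dots> \<le> (2 ^ K * (?p * ?q)) * ((2 ^ K * (?p * ?q)) * ((2 ^ K * ?q) * (3 * ?s)))"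
  proof -
    have "(\<Prod>k=1..K. N k) = ?p * ?q"
      using l prod.ub_add_nat[of 1 l N "K - l"] by simp
    then have A: "?A \<le> 2 ^ K * (?p * ?q)"
      using prod_Suc_le[of "{1..K}" N] pos by simp
    have "?B \<le> 2 ^ (K - l) * ?q"
      using prod_Suc_le[of "{l+1..K}" N] pos by simp
    \<comment> \<open>Weakened so that the constant does not depend on \<open>l\<close>.\<close>
    also have "\<dots> \<le> 2 ^ K * ?q"
      by (intro mult_right_mono power_increasing) auto
    finally have B: "?B \<le> 2 ^ K * ?q" .
    \<comment> \<open>Since \<open>l\<close> is at least 1, the sum is positive and absorbs the 1 in
      \<open>2 * ?s + 1\<close>.\<close>
    have "N 1 \<le> ?s" using l by (intro member_le_sum) auto
    then have "2 * ?s + 1 \<le> 3 * ?s" using pos[of 1] l by simp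
    then show ?thesis using A B by (intro mult_le_mono) auto
  qed
  also have "\<dots> = 3 * 8 ^ K * (?s * ?p\<^sup>2 * ?q ^ 3)"
  proof -
    have "(8::nat) ^ K = 2 ^ K * 2 ^ K * 2 ^ K"
      by (simp flip: power_mult_distrib)
    then show ?thesis by (simp add: power2_eq_square power3_eq_cube mult_ac)
  qed
  finally show ?thesis by (simp add: prod_power_distrib)
qed

section \<open>Executions of the algorithm\<close>

lemma process_all_length_le:
  assumes "process_all K N M R W l n \<alpha> ts s s'"
  shows "length (snd s') \<le> length ts + length (snd s)"
  using assms
proof (induction rule: process_all.induct)
  case (2 t s s' ts s'')
  from 2(1) have "length (snd s') \<le> Suc (length (snd s))"
    by cases auto
  with 2(3) show ?case by simp
qed simp

lemma process_all_exists: "\<exists>s'. process_all K N M R W l n \<alpha> ts s s'"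
proof (induction ts arbitrary: s)
  case Nil
  show ?case by (rule exI, rule process_all.intros(1))
next
  case (Cons t ts)
  obtain S T where s: "s = (S, T)" by (cases s)
  have "\<exists>s'. process K N M R W l n \<alpha> t s s'"
    \<comment> \<open>The four rules are exhaustive: either no candidate exists, or any candidate is
      already found, rejected or accepted.\<close>
    unfolding s by (meson process.intros)
  with Cons show ?case by (blast intro: process_all.intros)
qed

lemma process_mono:
  assumes "process K N M R W l n \<alpha> t s s'"
  shows "fst s \<subseteq> fst s'"
  using assms by cases auto

lemma process_sound:
  assumes "process K N M R W l n \<alpha> t s s'" "fst s \<subseteq> confidence_set K N M R W n \<alpha>"
  shows "fst s' \<subseteq> confidence_set K N M R W n \<alpha>"
  using assms
proof cases
  case (test_accepts v S T)
  then have "ate K N v \<in> confidence_set K N M R W n \<alpha>"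
    by (auto simp: confidence_set_def candidate_def)
  with assms(2) test_accepts show ?thesis by simp
qed auto

text \<open>The run may examine a candidate \<open>w\<close> other than \<open>v\<close>, but
  \<open>w\<close> has the same effect and p-value. So it cannot be rejected, and its effect is
  either already present or gets inserted.\<close>

lemma process_complete:
  assumes "process K N M R W l n \<alpha> t s s'" and v: "candidate K N M l n t v"
    and acc: "p_value K N M R W v n > \<alpha>"
    and design: "l \<le> K" "stratified_design K N M" "\<forall>k\<in>{1..l}. balanced N M k"
  shows "ate K N v \<in> fst s'"
  using assms(1)
proof cases
  case (no_candidate S T)
  with v show ?thesis by blast
next
  case (already_found w S T)
  with candidate_ate_eq[OF v _ design(1)] show ?thesis by simp
next
  case (test_rejects w S T)
  with candidate_p_value_eq[OF v _ design] acc show ?thesis by simp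
next
  case (test_accepts w S T)
  with candidate_ate_eq[OF v _ design(1)] show ?thesis by simp
qed

lemma process_all_mono:
  assumes "process_all K N M R W l n \<alpha> ts s s'"
  shows "fst s \<subseteq> fst s'"
  using assms by (induction rule: process_all.induct) (auto dest: process_mono)

lemma process_all_sound:
  assumes "process_all K N M R W l n \<alpha> ts s s'" "fst s \<subseteq> confidence_set K N M R W n \<alpha>"
  shows "fst s' \<subseteq> confidence_set K N M R W n \<alpha>"
  using assms by (induction rule: process_all.induct) (auto dest: process_sound)

lemma process_all_complete:
  assumes "process_all K N M R W l n \<alpha> ts s s'" "t \<in> set ts" "candidate K N M l n t v"
    and "p_value K N M R W v n > \<alpha>"
    and "l \<le> K" "stratified_design K N M" "\<forall>k\<in>{1..l}. balanced N M k"
  shows "ate K N v \<in> fst s'"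
  using assms(1,2)
proof (induction rule: process_all.induct)
  case (2 t' s s' ts s'')
  show ?case
  proof (cases "t = t'")
    case True
    with process_complete[OF _ assms(3-7)] 2(1) have "ate K N v \<in> fst s'" by blast
    \<comment> \<open>Later passes never remove an effect.\<close>
    with process_all_mono[OF 2(2)] show ?thesis by blast
  next
    case False
    with 2 show ?thesis by simp
  qed
qed simp

text \<open>Ensures that the claims about every run are not vacuous.\<close>

lemma algorithm_run_exists: "\<exists>S T. algorithm_run K N M R W l n \<alpha> S T"
proof -
  obtain ts where "distinct ts" "set ts = search_tuples K N l"
    using finite_distinct_list[OF finite_search_tuples] by blast
  moreover obtain S T where "process_all K N M R W l n \<alpha> ts ({}, []) (S, T)"
    using process_all_exists[of K N M R W l n \<alpha> ts "({}, [])"] by auto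
  ultimately show ?thesis unfolding algorithm_run_def by blast
qed

lemma algorithm_run_result:
  assumes run: "algorithm_run K N M R W l n \<alpha> S T"
    and design: "l \<le> K" "stratified_design K N M" "\<forall>k\<in>{1..l}. balanced N M k"
  shows "S = confidence_set K N M R W n \<alpha>"
proof
  obtain ts where ts: "set ts = search_tuples K N l"
    and p: "process_all K N M R W l n \<alpha> ts ({}, []) (S, T)"
    using run by (auto simp: algorithm_run_def)
  show "S \<subseteq> confidence_set K N M R W n \<alpha>"
    using process_all_sound[OF p] by simp
  show "confidence_set K N M R W n \<alpha> \<subseteq> S"
  proof
    fix x assume "x \<in> confidence_set K N M R W n \<alpha>"
    then obtain v where x: "x = ate K N v" and v: "potential_outcome_table K N v"
      "compatible K N M v n" "p_value K N M R W v n > \<alpha>"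
      by (auto simp: confidence_set_def)
    obtain t where "t \<in> set ts" "candidate K N M l n t v"
      using compatible_table_has_search_tuple[OF v(1,2) design(1)] ts by blast
    from process_all_complete[OF p this v(3) design] show "x \<in> S" by (simp add: x)
  qed
qed

lemma algorithm_run_length_le:
  assumes "algorithm_run K N M R W l n \<alpha> S T"
  shows "length T \<le> card (search_tuples K N l)"
  using assms unfolding algorithm_run_def
  by (metis process_all_length_le distinct_card add_0_right list.size(3) snd_conv)

theorem theoremB2:
  fixes K :: nat
  shows "\<exists>C::real. \<forall>(N::nat \<Rightarrow> nat) (M::nat \<Rightarrow> nat) (l::nat) (n::table) (\<alpha>::real)
             (R::nat) (W::nat \<Rightarrow> allocation).
           stratified_design K N M \<longrightarrow>
           1 \<le> l \<longrightarrow> l \<le> K \<longrightarrow> (\<forall>k\<in>{1..l}. balanced N M k) \<longrightarrow>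
           outcome_table K N M n \<longrightarrow>
           0 < \<alpha> \<longrightarrow> \<alpha> < 1 \<longrightarrow>
           (\<forall>r\<in>{1..R}. W r \<in> allocations K N M) \<longrightarrow>
           (\<exists>S T. algorithm_run K N M R W l n \<alpha> S T) \<and>
           (\<forall>S T. algorithm_run K N M R W l n \<alpha> S T \<longrightarrow>
              S = confidence_set K N M R W n \<alpha> \<and>
              real (length T) \<le>
                C * real ((\<Sum>k=1..l. N k) * (\<Prod>k=1..l. (N k)\<^sup>2) * (\<Prod>k=l+1..K. (N k) ^ 3)))"
\<comment> \<open>The constant is the one from \<open>card_search_tuples_le\<close>; it depends on
  \<open>K\<close> alone, and each tuple causes at most one test.\<close>
proof (intro exI[of _ "3 * 8 ^ K :: real"] allI impI conjI)
  fix N M :: "nat \<Rightarrow> nat" and l :: nat and n :: table and \<alpha> :: real and R :: nat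
    and W :: "nat \<Rightarrow> allocation"
  assume design: "stratified_design K N M" and l: "1 \<le> l" "l \<le> K"
    and bal: "\<forall>k\<in>{1..l}. balanced N M k"
  show "\<exists>S T. algorithm_run K N M R W l n \<alpha> S T"
    by (rule algorithm_run_exists)
  fix S T assume run: "algorithm_run K N M R W l n \<alpha> S T"
  show "S = confidence_set K N M R W n \<alpha>"
    by (rule algorithm_run_result[OF run l(2) design bal])
  have "N k \<ge> 1" if "k \<in> {1..K}" for k
    using design that by (force simp: stratified_design_def)
  from algorithm_run_length_le[OF run] card_search_tuples_le[of l K N, OF l this]
  have "length T \<le> 3 * 8 ^ K *
      ((\<Sum>k=1..l. N k) * (\<Prod>k=1..l. (N k)\<^sup>2) * (\<Prod>k=l+1..K. (N k) ^ 3))"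
    by (rule le_trans)
  then have "real (length T) \<le> real (3 * 8 ^ K *
      ((\<Sum>k=1..l. N k) * (\<Prod>k=1..l. (N k)\<^sup>2) * (\<Prod>k=l+1..K. (N k) ^ 3)))"
    by (rule of_nat_mono)
  then show "real (length T) \<le> 3 * 8 ^ K *
      real ((\<Sum>k=1..l. N k) * (\<Prod>k=1..l. (N k)\<^sup>2) * (\<Prod>k=l+1..K. (N k) ^ 3))"
    by (simp only: of_nat_mult of_nat_power of_nat_numeral)
qed

end
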